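(* Let $\xi=\frac{3-\sqrt5}{2}$. For the pairwise independent prophet inequality with $n$ rewards and target approximation parameter $\varepsilon>0$, the algorithm $\mathrm{ALG}$ described in the context achieves a $(1-\varepsilon)$-competition complexity $k(n,\varepsilon)$ of $$\left\lceil\log_2\log_{(1+\xi)}\frac1\varepsilon\right\rceil+4 .$$
   Context: Model. $F$ is a known joint distribution over sequences $v=(v_1,\dots,v_n)\in\mathbb{R}_{\ge0}^n$ such that $v_i$ and $v_j$ are independent for all $i\ne j$ (pairwise independence; no further independence is assumed). Standing assumptions: $F$ is discrete and every $v$ in its support has a unique maximal coordinate. Given $k$ independent copies $v^{(1)},\dots,v^{(k)}\sim F$ (rounds), the rewards are revealed one by one in the order $v^{(1)}_1,\dots,v^{(1)}_n,v^{(2)}_1,\dots,v^{(k)}_n$. An online algorithm, knowing $F$, must upon seeing each reward decide irrevocably to select it and stop, or discard it; $\mathrm{ALG}(v)$ is the selected value ($0$ if none). The $(1-\varepsilon)$-competition complexity of an algorithm $\mathrm{ALG}$ (in this pairwise independent setting) is the smallest positive integer $k(n,\varepsilon)$ such that for every such $F$ and every $k\ge k(n,\varepsilon)$, $\mathbb{E}_{v\sim F^k}[\mathrm{ALG}(v)]\ge(1-\varepsilon)\,\mathbb{E}_{v\sim F}[\max_i v_i]$. $F^*$ is the distribution of $\max_i v_i$ for $v\sim F$. A $q$-quantile threshold of a distribution $D$ is a value $T$ with $\Pr_{w\sim D}[w<T]\le q\le\Pr_{w\sim D}[w\le T]$. The algorithm. Let $T_0$ be a threshold with $\sum_i\Pr[v_i>T_0]\le\xi\le\sum_i\Pr[v_i\ge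 T_0]$. Phase 1 (first 2 rounds): select the first reward with value strictly greater than $T_0$, if any, and stop. Phase 2 (next $m_2=\lceil\log_2\log_{(1+\xi)}\frac1\varepsilon\rceil+2$ rounds, if nothing was selected in Phase 1): let $p=\Pr_{v\sim F}[\max_j v_j<T_0]$ and, for $i\ge1$, let $T_i$ be a $p^{(2^i)}$-quantile threshold of $F^*$; in the $t$-th round of Phase 2 ($t=1,\dots,m_2$) select the first reward of the round with value at least $T_{\max\{t-2,0\}}$, if any, and stop.
   Formalization: Proved for 0<ε<(1+ξ)^(-1/4), i.e. ε<1 and m_2≥1: for ε≥1 the formula is undefined, and for other ε the claim fails (v_1=1, other rewards 0: T_0=1, Phase 1 never selects). "Achieves complexity K" means the guarantee holds for all k≥K, so the least such integer is at most K. *)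

theory Defs
  imports "HOL-Probability.Probability"
begin

text \<open>
  A reward vector is a list of length \<open>n\<close>; the list order is the order of arrival within a
  round. Discreteness of \<open>F\<close> is the use of a pmf (countable support). Existence in the
  unique-maximum condition forces \<open>n \<ge> 1\<close>.
\<close>
definition prophet_instance :: "nat \<Rightarrow> real list pmf \<Rightarrow> bool" where
  "prophet_instance n F \<longleftrightarrow>
     (\<forall>v\<in>set_pmf F. length v = n \<and> (\<forall>x\<in>set v. 0 \<le> x) \<and>
        (\<exists>!i. i < n \<and> (\<forall>j<n. v ! j \<le> v ! i))) \<and>
     (\<forall>i<n. \<forall>j<n. i \<noteq> j \<longrightarrow>
        prob_space.indep_var (measure_pmf F) borel (\<lambda>v. v ! i) borel (\<lambda>v. v ! j))"

text \<open>
  An online algorithm sees the nonempty prefix of rewards revealed so far and decides whether to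
  select the last of them. Knowledge of \<open>F\<close> is the first argument of \<^typ>\<open>real list pmf \<Rightarrow> real list \<Rightarrow> bool\<close>.
\<close>
definition selected_value :: "(real list \<Rightarrow> bool) \<Rightarrow> real list \<Rightarrow> real" where
  "selected_value A xs =
     (case find (\<lambda>t. A (take (Suc t) xs)) [0..<length xs] of None \<Rightarrow> 0 | Some t \<Rightarrow> xs ! t)"

text \<open>
  Expectations are taken in \<^typ>\<open>ennreal\<close>, so that an infinite expected maximum is not
  silently read as 0. All integrands are nonnegative on the support.
\<close>
definition expected_max :: "real list pmf \<Rightarrow> ennreal" where
  "expected_max F = (\<integral>\<^sup>+ v. ennreal (Max (set v)) \<partial>measure_pmf F)"

definition expected_alg ::
    "(real list pmf \<Rightarrow> real list \<Rightarrow> bool) \<Rightarrow> real list pmf \<Rightarrow> nat \<Rightarrow> ennreal" where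
  "expected_alg ALG F k =
     (\<integral>\<^sup>+ vs. ennreal (selected_value (ALG F) (concat vs)) \<partial>measure_pmf (replicate_pmf k F))"

definition achieves_competition_complexity ::
    "(real list pmf \<Rightarrow> real list \<Rightarrow> bool) \<Rightarrow> nat \<Rightarrow> real \<Rightarrow> nat \<Rightarrow> bool" where
  "achieves_competition_complexity ALG n \<epsilon> K \<longleftrightarrow> 0 < K \<and>
     (\<forall>F. prophet_instance n F \<longrightarrow>
        (\<forall>k\<ge>K. expected_alg ALG F k \<ge> ennreal (1 - \<epsilon>) * expected_max F))"

definition competition_complexity ::
    "(real list pmf \<Rightarrow> real list \<Rightarrow> bool) \<Rightarrow> nat \<Rightarrow> real \<Rightarrow> nat" where
  "competition_complexity ALG n \<epsilon> = (LEAST K. achieves_competition_complexity ALG n \<epsilon> K)"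

definition is_quantile :: "real \<Rightarrow> real pmf \<Rightarrow> real \<Rightarrow> bool" where
  "is_quantile q D T \<longleftrightarrow>
     measure_pmf.prob D {w. w < T} \<le> q \<and> q \<le> measure_pmf.prob D {w. w \<le> T}"

definition max_pmf :: "real list pmf \<Rightarrow> real pmf" where
  "max_pmf F = map_pmf (\<lambda>v. Max (set v)) F"

definition \<xi> :: real where
  "\<xi> = (3 - sqrt 5) / 2"

definition valid_thresholds :: "nat \<Rightarrow> real list pmf \<Rightarrow> (nat \<Rightarrow> real) \<Rightarrow> bool" where
  "valid_thresholds n F T \<longleftrightarrow>
     (\<Sum>i<n. measure_pmf.prob F {v. v ! i > T 0}) \<le> \<xi> \<and>
     \<xi> \<le> (\<Sum>i<n. measure_pmf.prob F {v. v ! i \<ge> T 0}) \<and>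
     (let p = measure_pmf.prob F {v. Max (set v) < T 0}
      in \<forall>i\<ge>1. is_quantile (p ^ (2 ^ i)) (max_pmf F) (T i))"

definition phase2_rounds :: "real \<Rightarrow> int" where
  "phase2_rounds \<epsilon> = \<lceil>log 2 (log (1 + \<xi>) (1 / \<epsilon>))\<rceil> + 2"

text \<open>
  \<open>r\<close> is the (1-based) round of the current reward, \<open>t\<close> its round within Phase 2; the truncated
  subtraction \<open>t - 2\<close> on \<^typ>\<open>nat\<close> is \<open>max {t - 2, 0}\<close>. ``First reward'' needs no mention,
  since the run stops at the first selection. After Phase 2 nothing is selected.
\<close>
definition two_phase ::
    "(real list pmf \<Rightarrow> nat \<Rightarrow> real) \<Rightarrow> nat \<Rightarrow> real \<Rightarrow> real list pmf \<Rightarrow> real list \<Rightarrow> bool" where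
  "two_phase T n \<epsilon> F h =
     (let x = last h; r = (length h - 1) div n + 1; t = r - 2
      in if r \<le> 2 then x > T F 0
         else int t \<le> phase2_rounds \<epsilon> \<and> x \<ge> T F (t - 2))"

end

theory Submission
  imports Defs
begin

text \<open>
  It suffices to compare tails: \<open>P(ALG > x) \<ge> (1 - \<epsilon>) P(max > x)\<close> for every \<open>x \<ge> 0\<close>. For
  \<open>x \<ge> T 0\<close> the two rounds of Phase 1 already give \<open>P(ALG > x) \<ge> \<Sum>\<^sub>i P(v\<^sub>i > x)\<close>. For \<open>x < T 0\<close>
  let \<open>T i\<close> be the first threshold that is at most \<open>x\<close>. The algorithm can fail to exceed \<open>x\<close> only
  by stopping in none of the rounds that use earlier thresholds, which has probability at most
  \<open>p ^ 2 ^ i\<close>, while \<open>P(max \<le> x) \<ge> P(max \<le> T i) \<ge> p ^ 2 ^ i\<close> by the choice of the quantile. If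
  every threshold exceeds \<open>x\<close>, the failure probability is a power of \<open>p\<close> that is at most \<open>\<epsilon>\<close>, since
  a second moment bound gives \<open>p \<le> 1 / (1 + \<xi>)\<close>.
\<close>

section \<open>Runs of an online rule, unfolded round by round\<close>

lemma find_map: "find P (map f xs) = map_option f (find (P \<circ> f) xs)"
  by (induction xs) auto

lemma selected_value_Nil [simp]: "selected_value A [] = 0"
  by (simp add: selected_value_def)

lemma selected_value_Cons [simp]:
  "selected_value A (x # xs) = (if A [x] then x else selected_value (\<lambda>h. A (x # h)) xs)"
proof -
  have "[0..<length (x # xs)] = 0 # map Suc [0..<length xs]"
    by (simp add: upt_conv_Cons map_Suc_upt del: upt_Suc)
  then show ?thesis
    unfolding selected_value_def
    by (auto simp: find_map o_def split: option.splits simp del: upt_Suc)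
qed

lemma selected_value_append:
  assumes "\<And>t. t < length v \<Longrightarrow> A (take (Suc t) v) = P (v ! t)"
  shows "selected_value A (v @ ys) =
    (case find P v of None \<Rightarrow> selected_value (\<lambda>h. A (v @ h)) ys | Some y \<Rightarrow> y)"
  using assms
proof (induction v arbitrary: A)
  case (Cons x v)
  have "A [x] = P x"
    using Cons.prems[of 0] by simp
  moreover have "A (x # take (Suc t) v) = P (v ! t)" if "t < length v" for t
    using Cons.prems[of "Suc t"] that by simp
  ultimately show ?case
    using Cons.IH[of "\<lambda>h. A (x # h)"] by (simp split: option.split)
qed simp

text \<open>Here \<open>Q r y\<close> is the decision of a memoryless rule on reward
  \<open>y\<close> in round \<open>r\<close>. Shifting \<open>Q\<close> makes the recursion follow
  that of \<open>replicate_pmf\<close>, so that rounds can be peeled off from the front.\<close>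

primrec run_rounds :: "(nat \<Rightarrow> real \<Rightarrow> bool) \<Rightarrow> real list list \<Rightarrow> real" where
  "run_rounds Q [] = 0"
| "run_rounds Q (v # vs) =
     (case find (Q 0) v of None \<Rightarrow> run_rounds (\<lambda>r. Q (Suc r)) vs | Some y \<Rightarrow> y)"

text \<open>All rounds have length \<open>n\<close>, so the length of the history determines the
  current round, counted from 0. This replaces a rule on histories by \<open>Q\<close>.\<close>

lemma selected_value_concat:
  assumes "0 < n" and "\<And>v. v \<in> set vs \<Longrightarrow> length v = n"
    and "\<And>h. h \<noteq> [] \<Longrightarrow> A h = Q ((length h - 1) div n) (last h)"
  shows "selected_value A (concat vs) = run_rounds Q vs"
  using assms(2,3)
proof (induction vs arbitrary: A Q)
  case (Cons v vs)
  have len: "length v = n"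
    using Cons.prems(1) by simp
  have "A (take (Suc t) v) = Q 0 (v ! t)" if "t < length v" for t
  proof -
    have "take (Suc t) v \<noteq> []"
      using that by auto
    with Cons.prems(2)[OF this] that len show ?thesis
      by (simp add: take_Suc_conv_app_nth)
  qed
  note app = selected_value_append[of v A "Q 0", OF this]
  have "A (v @ h) = Q (Suc ((length h - 1) div n)) (last h)" if "h \<noteq> []" for h
  proof -
    have "length (v @ h) - 1 = n + (length h - 1)"
      using that len by (cases h) auto
    moreover have "(n + (length h - 1)) div n = Suc ((length h - 1) div n)"
      using assms(1) by simp
    ultimately show ?thesis
      using Cons.prems(2)[of "v @ h"] that by (metis append_is_Nil_conv last_appendR)
  qed
  then have "selected_value (\<lambda>h. A (v @ h)) (concat vs) = run_rounds (\<lambda>r. Q (Suc r)) vs"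
    using Cons.prems(1) by (intro Cons.IH) auto
  with app show ?case
    by (simp split: option.split)
qed simp

text \<open>Conditioning on the first round: the two ways to exceed \<open>x\<close> are disjoint,
  and the remaining rounds are independent of the first.\<close>

lemma prob_run_rounds_Suc:
  "measure_pmf.prob (replicate_pmf (Suc k) F) {vs. x < run_rounds Q vs} =
     measure_pmf.prob F {v. \<exists>y. find (Q 0) v = Some y \<and> x < y} +
     measure_pmf.prob F {v. find (Q 0) v = None} *
       measure_pmf.prob (replicate_pmf k F) {vs. x < run_rounds (\<lambda>r. Q (Suc r)) vs}"
    (is "?l = ?s + ?q * ?g")
proof -
  \<comment> \<open>Once the first round \<open>v\<close> is fixed, at most one of the two summands
    is nonzero.\<close>
  have *: "emeasure (bind_pmf (replicate_pmf k F) (\<lambda>vs. return_pmf (v # vs))) {vs. x < run_rounds Q vs} =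
      indicator {v. \<exists>y. find (Q 0) v = Some y \<and> x < y} v +
      indicator {v. find (Q 0) v = None} v * ennreal ?g" for v
  proof -
    have "bind_pmf (replicate_pmf k F) (\<lambda>vs. return_pmf (v # vs)) = map_pmf ((#) v) (replicate_pmf k F)"
      by (simp add: map_pmf_def)
    then have "emeasure (bind_pmf (replicate_pmf k F) (\<lambda>vs. return_pmf (v # vs))) {vs. x < run_rounds Q vs} =
        emeasure (replicate_pmf k F) {vs. x < run_rounds Q (v # vs)}"
      by (simp add: vimage_def)
    then show ?thesis
      by (cases "find (Q 0) v")
        (auto simp: measure_pmf.emeasure_eq_measure split: split_indicator)
  qed
  have "ennreal ?l = emeasure (replicate_pmf (Suc k) F) {vs. x < run_rounds Q vs}"
    by (simp only: measure_pmf.emeasure_eq_measure)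
  also have "\<dots> = (\<integral>\<^sup>+v. (indicator {v. \<exists>y. find (Q 0) v = Some y \<and> x < y} v +
      indicator {v. find (Q 0) v = None} v * ennreal ?g) \<partial>F)"
    unfolding replicate_pmf.simps emeasure_bind_pmf[of F] * ..
  also have "\<dots> = ennreal ?s + ennreal ?q * ennreal ?g"
    by (subst nn_integral_add) (auto simp: nn_integral_multc measure_pmf.emeasure_eq_measure)
  also have "\<dots> = ennreal (?s + ?q * ?g)"
    by (simp add: ennreal_mult)
  finally show ?thesis
    by (subst (asm) ennreal_inj) auto
qed

section \<open>Expectations as integrals of tails\<close>

text \<open>Layer cake formula. Since \<open>ennreal\<close> sends negative values to 0, cutting the
  tail to nonnegative \<open>x\<close> allows \<open>f\<close> of any sign.\<close>

lemma nn_integral_tail: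
  fixes f :: "'a \<Rightarrow> real"
  shows "(\<integral>\<^sup>+v. ennreal (f v) \<partial>measure_pmf D) =
    (\<integral>\<^sup>+x. ennreal (measure_pmf.prob D {v. x < f v}) * indicator {0..} x \<partial>lborel)"
proof -
  interpret pair_sigma_finite "measure_pmf D" lborel ..
  define g where "g = (\<lambda>v x. indicator {x. 0 \<le> x \<and> x < f v} x :: ennreal)"
  have "ennreal (f v) = (\<integral>\<^sup>+x. g v x \<partial>lborel)" for v
  proof -
    have "{x. 0 \<le> x \<and> x < f v} = {0..<f v}"
      by auto
    then show ?thesis
      by (cases "0 \<le> f v") (auto simp: g_def ennreal_neg)
  qed
  moreover have "ennreal (measure_pmf.prob D {v. x < f v}) * indicator {0..} x =
      (\<integral>\<^sup>+v. g v x \<partial>measure_pmf D)" for x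
  proof -
    have "(\<integral>\<^sup>+v. g v x \<partial>measure_pmf D) =
        (\<integral>\<^sup>+v. indicator {v. x < f v} v * indicator {0..} x \<partial>measure_pmf D)"
      by (intro nn_integral_cong) (auto simp: g_def split: split_indicator)
    then show ?thesis
      by (simp add: nn_integral_multc measure_pmf.emeasure_eq_measure)
  qed
  \<comment> \<open>Exchanging the integrals requires joint measurability; \<open>g\<close> is the
    indicator of a measurable set in the product.\<close>
  moreover have "case_prod g \<in> borel_measurable (measure_pmf D \<Otimes>\<^sub>M lborel)"
  proof -
    have [measurable]: "f \<in> borel_measurable (measure_pmf D)"
      by simp
    have "case_prod g = indicator {z \<in> space (measure_pmf D \<Otimes>\<^sub>M lborel). 0 \<le> snd z \<and> snd z < f (fst z)}"
      by (auto simp: g_def fun_eq_iff space_pair_measure split: split_indicator)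
    then show ?thesis
      by simp
  qed
  ultimately show ?thesis
    using Fubini'[of g] by simp
qed

section \<open>Pairwise independent events\<close>

text \<open>Second moment method: where no event occurs, the count \<open>N\<close> vanishes and (1
  - c N)^2 is 1; elsewhere it is nonnegative. Its expectation therefore bounds the probability, and
  it involves intersections of pairs only.\<close>

lemma (in prob_space) prob_no_event_le:
  assumes fin: "finite I" and ev: "\<And>i. i \<in> I \<Longrightarrow> A i \<in> events"
    and indep: "\<And>i j. i \<in> I \<Longrightarrow> j \<in> I \<Longrightarrow> i \<noteq> j \<Longrightarrow> prob (A i \<inter> A j) = prob (A i) * prob (A j)"
  shows "prob (space M - (\<Union>i\<in>I. A i)) \<le> 1 / (1 + (\<Sum>i\<in>I. prob (A i)))"
proof -
  define s where "s = (\<Sum>i\<in>I. prob (A i))"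
  \<comment> \<open>This \<open>c\<close> minimises 1 - 2 c s + c^2 (s + s^2).\<close>
  define c where "c = 1 / (1 + s)"
  define N :: "'a \<Rightarrow> real" where "N = (\<lambda>w. \<Sum>i\<in>I. indicator (A i) w)"
  have s0: "0 \<le> s"
    unfolding s_def by (intro sum_nonneg) auto
  have N2: "N w ^ 2 = (\<Sum>i\<in>I. \<Sum>j\<in>I. indicator (A i \<inter> A j) w)" for w
    by (simp add: N_def power2_eq_square sum_product indicator_inter_arith)
  have int: "integrable M (indicator (A i \<inter> A j) :: 'a \<Rightarrow> real)" if "i \<in> I" "j \<in> I" for i j
    using ev that by (intro integrable_real_indicator) (auto simp: less_top[symmetric])
  have intN: "integrable M N" "integrable M (\<lambda>w. N w ^ 2)"
    unfolding N2 using int int[of i i for i] by (auto simp: N_def[abs_def])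
  have EN: "expectation N = s"
    using int[of i i for i] by (auto simp: N_def s_def ev sets.Int_space_eq2 intro!: sum.cong)
  have "expectation (\<lambda>w. N w ^ 2) = (\<Sum>i\<in>I. \<Sum>j\<in>I. prob (A i \<inter> A j))"
    unfolding N2 using int ev
    by (subst Bochner_Integration.integral_sum, (auto)[1], intro sum.cong refl,
        subst Bochner_Integration.integral_sum) (auto intro!: sum.cong simp: sets.Int_space_eq2)
  \<comment> \<open>A diagonal term is just \<open>prob (A i)\<close>; adding its square completes
    the double sum to \<open>s ^ 2\<close>.\<close>
  also have "\<dots> \<le> (\<Sum>i\<in>I. \<Sum>j\<in>I. (if i = j then prob (A i) else 0) + prob (A i) * prob (A j))"
    by (intro sum_mono) (auto simp: indep)
  also have "\<dots> = s + s ^ 2"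
    using fin by (simp add: sum.distrib s_def power2_eq_square sum_product)
  finally have EN2: "expectation (\<lambda>w. N w ^ 2) \<le> s + s ^ 2" .
  have "prob (space M - (\<Union>i\<in>I. A i)) = expectation (indicator (space M - (\<Union>i\<in>I. A i)))"
    using fin ev by (simp add: sets.Int_space_eq2 Int_absorb2)
  also have "\<dots> \<le> expectation (\<lambda>w. 1 - 2 * c * N w + c ^ 2 * N w ^ 2)"
  proof (rule integral_mono)
    show "integrable M (indicator (space M - (\<Union>i\<in>I. A i)) :: 'a \<Rightarrow> real)"
      using fin ev by (intro integrable_real_indicator) (auto simp: less_top[symmetric])
    show "integrable M (\<lambda>w. 1 - 2 * c * N w + c ^ 2 * N w ^ 2)"
      using intN by auto
    fix w
    have "1 - 2 * c * N w + c ^ 2 * N w ^ 2 = (1 - c * N w) ^ 2"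
      by (simp add: power2_eq_square algebra_simps)
    moreover have "N w = 0" if "w \<notin> (\<Union>i\<in>I. A i)"
      using that by (auto simp: N_def intro!: sum.neutral)
    ultimately show "indicator (space M - (\<Union>i\<in>I. A i)) w \<le> 1 - 2 * c * N w + c ^ 2 * N w ^ 2"
      by (auto split: split_indicator)
  qed
  also have "\<dots> = 1 - 2 * c * s + c ^ 2 * expectation (\<lambda>w. N w ^ 2)"
    using intN EN by (simp add: prob_space)
  also have "\<dots> \<le> 1 - 2 * c * s + c ^ 2 * (s + s ^ 2)"
    using EN2 by (intro add_left_mono mult_left_mono) auto
  also have "\<dots> = 1 / (1 + s)"
  proof -
    have cu: "c * (1 + s) = 1"
      using s0 by (simp add: c_def)
    have "c ^ 2 * (s + s ^ 2) = (c * (1 + s)) * (c * s)"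
      by (simp add: power2_eq_square algebra_simps)
    with cu show ?thesis
      by (simp add: c_def[symmetric] algebra_simps)
  qed
  finally show ?thesis
    unfolding s_def .
qed

text \<open>
  The event bounded from below says that the first of the events \<open>B i\<close> to occur happens at an
  index whose stronger event \<open>A i\<close> occurs too; pairwise independence enters through a union bound.
\<close>
lemma (in prob_space) prob_first_event_ge:
  fixes A B :: "nat \<Rightarrow> 'a set"
  assumes ev: "\<And>i. i < n \<Longrightarrow> A i \<in> events" "\<And>i. i < n \<Longrightarrow> B i \<in> events"
    and sub: "\<And>i. i < n \<Longrightarrow> A i \<subseteq> B i"
    and indep: "\<And>i j. i < n \<Longrightarrow> j < n \<Longrightarrow> i \<noteq> j \<Longrightarrow> prob (A i \<inter> B j) = prob (A i) * prob (B j)"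
  shows "(1 - (\<Sum>i<n. prob (B i))) * (\<Sum>i<n. prob (A i)) \<le> prob (\<Union>i<n. A i - (\<Union>j<i. B j))"
proof -
  define s where "s = (\<Sum>i<n. prob (B i))"
  have "prob (A i) * (1 - s) \<le> prob (A i - (\<Union>j<i. B j))" if i: "i < n" for i
  proof -
    have "prob (A i \<inter> (\<Union>j<i. B j)) = prob (\<Union>j<i. A i \<inter> B j)"
      by (simp only: Int_UN_distrib)
    also have "\<dots> \<le> (\<Sum>j<i. prob (A i \<inter> B j))"
      using ev i by (intro finite_measure_subadditive_finite) auto
    also have "\<dots> = (\<Sum>j<i. prob (A i) * prob (B j))"
      using i by (intro sum.cong) (auto simp: indep)
    \<comment> \<open>Enlarging the range of \<open>j\<close> gives a factor that is the same for
      every \<open>i\<close>.\<close>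
    also have "\<dots> \<le> (\<Sum>j<n. prob (A i) * prob (B j))"
      using i by (intro sum_mono2) auto
    also have "\<dots> = prob (A i) * s"
      by (simp add: s_def sum_distrib_left)
    finally have "prob (A i \<inter> (\<Union>j<i. B j)) \<le> prob (A i) * s" .
    moreover have "prob (A i - (\<Union>j<i. B j)) = prob (A i) - prob (A i \<inter> (\<Union>j<i. B j))"
      using ev i by (intro finite_measure_Diff') auto
    ultimately show ?thesis
      by (simp add: algebra_simps)
  qed
  then have "(\<Sum>i<n. prob (A i) * (1 - s)) \<le> (\<Sum>i<n. prob (A i - (\<Union>j<i. B j)))"
    by (intro sum_mono) auto
  also have "\<dots> = prob (\<Union>i<n. A i - (\<Union>j<i. B j))"
  proof (rule finite_measure_finite_Union[symmetric])
    show "disjoint_family_on (\<lambda>i. A i - (\<Union>j<i. B j)) {..<n}"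
    proof (unfold disjoint_family_on_def, intro ballI impI)
      fix i j assume "i \<in> {..<n}" "j \<in> {..<n}" "i \<noteq> j"
      \<comment> \<open>The set of smaller index lies in its own \<open>B\<close>, which is removed
        from the other set.\<close>
      then consider "i < j" "A i \<subseteq> B i" | "j < i" "A j \<subseteq> B j"
        using sub by (meson lessThan_iff linorder_neqE_nat)
      then show "(A i - (\<Union>j<i. B j)) \<inter> (A j - (\<Union>i<j. B i)) = {}"
        by cases blast+
    qed
  qed (use ev in \<open>auto intro!: sets.Diff sets.finite_UN\<close>)
  finally show ?thesis
    by (simp add: s_def sum_distrib_right mult.commute)
qed

section \<open>Comparing expectations through their tails\<close>

lemma nn_integral_le_of_tail_le:
  fixes f :: "'a \<Rightarrow> real" and g :: "'b \<Rightarrow> real"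
  assumes "0 \<le> c"
    and "\<And>x. 0 \<le> x \<Longrightarrow> c * measure_pmf.prob D {v. x < f v} \<le> measure_pmf.prob E {w. x < g w}"
  shows "ennreal c * (\<integral>\<^sup>+v. ennreal (f v) \<partial>measure_pmf D) \<le> (\<integral>\<^sup>+w. ennreal (g w) \<partial>measure_pmf E)"
proof -
  let ?h = "\<lambda>x. ennreal (measure_pmf.prob D {v. x < f v}) * indicator {0..} x"
  \<comment> \<open>The tail is antitone in \<open>x\<close>; its negative is monotone and hence
    Borel.\<close>
  have "(\<lambda>x. - measure_pmf.prob D {v. x < f v}) \<in> borel_measurable borel"
    by (intro borel_measurable_mono monoI) (auto intro!: measure_pmf.finite_measure_mono)
  then have [measurable]: "(\<lambda>x. measure_pmf.prob D {v. x < f v}) \<in> borel_measurable borel"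
    by simp
  have "ennreal c * (\<integral>\<^sup>+v. ennreal (f v) \<partial>measure_pmf D) = (\<integral>\<^sup>+x. ennreal c * ?h x \<partial>lborel)"
    by (subst nn_integral_cmult) (auto simp: nn_integral_tail)
  also have "\<dots> \<le> (\<integral>\<^sup>+x. ennreal (measure_pmf.prob E {w. x < g w}) * indicator {0..} x \<partial>lborel)"
    using assms
    by (intro nn_integral_mono) (auto simp: ennreal_mult[symmetric] split: split_indicator)
  finally show ?thesis
    by (simp add: nn_integral_tail)
qed

section \<open>Events on a prophet instance\<close>

lemma prophet_instance_pos: "0 < n" if "prophet_instance n F"
proof -
  obtain v where "v \<in> set_pmf F"
    using set_pmf_not_empty[of F] by blast
  with that show ?thesis
    unfolding prophet_instance_def by (metis gr_zeroI not_less0)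
qed

lemma prophet_instance_length: "length v = n" if "prophet_instance n F" "v \<in> set_pmf F"
  using that unfolding prophet_instance_def by blast

lemma prophet_instance_indep:
  assumes "prophet_instance n F" "i < n" "j < n" "i \<noteq> j" "X \<in> sets borel" "Y \<in> sets borel"
  shows "measure_pmf.prob F ({v. v ! i \<in> X} \<inter> {v. v ! j \<in> Y}) =
    measure_pmf.prob F {v. v ! i \<in> X} * measure_pmf.prob F {v. v ! j \<in> Y}"
proof -
  have "prob_space.indep_var (measure_pmf F) borel (\<lambda>v. v ! i) borel (\<lambda>v. v ! j)"
    using assms unfolding prophet_instance_def by blast
  from prob_space.indep_varD[OF measure_pmf.prob_space_axioms this assms(5,6)] show ?thesis
    by (simp add: vimage_def Collect_conj_eq)
qed

lemma prob_pmf_mono: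
  assumes "\<And>v. v \<in> set_pmf F \<Longrightarrow> v \<in> A \<Longrightarrow> v \<in> B"
  shows "measure_pmf.prob F A \<le> measure_pmf.prob F B"
  using assms by (intro measure_pmf.finite_measure_mono_AE) (auto simp: AE_measure_pmf_iff)

lemma prob_find_None:
  assumes "prophet_instance n F"
  shows "measure_pmf.prob F {v. find (\<lambda>y. t \<le> y) v = None} = measure_pmf.prob F {v. Max (set v) < t}"
proof -
  have "find (\<lambda>y. t \<le> y) v = None \<longleftrightarrow> Max (set v) < t" if "v \<in> set_pmf F" for v
  proof -
    have "v \<noteq> []"
      using prophet_instance_pos[OF assms] prophet_instance_length[OF assms that] by auto
    then show ?thesis
      by (auto simp: find_None_iff not_le)
  qed
  then show ?thesis
    by (intro antisym prob_pmf_mono) auto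
qed

section \<open>The constant \<xi> and Phase 1\<close>

lemma xi_identity: "(1 - \<xi>) * (2 - \<xi>) = 1"
  unfolding \<xi>_def by (simp add: field_simps)

lemma xi_pos: "0 < \<xi>" and xi_less_1: "\<xi> < 1"
proof -
  have "sqrt 5 < sqrt (3^2)" "sqrt (1^2) < sqrt 5"
    by (rule real_sqrt_less_mono; simp)+
  then show "0 < \<xi>" "\<xi> < 1"
    unfolding \<xi>_def by auto
qed

text \<open>
  A round keeps a fraction \<open>1 - \<xi>\<close> of the union bound on the tail of the maximum, and the second
  round is reached with probability at least \<open>1 - \<xi>\<close>; \<open>\<xi>\<close> is the number for which
  \<open>(1 - \<xi>) + (1 - \<xi>)\<^sup>2 = 1\<close>.
\<close>
lemma prob_run_rounds_above:
  assumes inst: "prophet_instance n F"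
    and s: "(\<Sum>i<n. measure_pmf.prob F {v. t < v ! i}) \<le> \<xi>"
    and x: "t \<le> x"
    and Q: "Q 0 = (\<lambda>y. t < y)" "Q 1 = (\<lambda>y. t < y)"
  shows "measure_pmf.prob F {v. x < Max (set v)}
    \<le> measure_pmf.prob (replicate_pmf (Suc (Suc k)) F) {vs. x < run_rounds Q vs}"
proof -
  define a where "a = (\<Sum>i<n. measure_pmf.prob F {v. x < v ! i})"
  define u where "u = measure_pmf.prob F {v. \<exists>y. find (\<lambda>y. t < y) v = Some y \<and> x < y}"
  define q where "q = measure_pmf.prob F {v. find (\<lambda>y. t < y) v = None}"
  have a0: "0 \<le> a"
    unfolding a_def by (intro sum_nonneg) auto
  have "measure_pmf.prob F {v. x < Max (set v)} \<le> measure_pmf.prob F (\<Union>i<n. {v. x < v ! i})"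
  proof (rule prob_pmf_mono)
    fix v assume "v \<in> set_pmf F" and v: "v \<in> {v. x < Max (set v)}"
    then have "length v = n" "v \<noteq> []"
      using prophet_instance_pos[OF inst] prophet_instance_length[OF inst] by auto
    then obtain i where "i < n" "v ! i = Max (set v)"
      by (metis List.finite_set Max_in in_set_conv_nth set_empty)
    with v show "v \<in> (\<Union>i<n. {v. x < v ! i})"
      by (intro UN_I[of i]) simp_all
  qed
  also have "\<dots> \<le> a"
    unfolding a_def by (intro measure_pmf.finite_measure_subadditive_finite) auto
  finally have max_le: "measure_pmf.prob F {v. x < Max (set v)} \<le> a" .
  have "(1 - \<xi>) * a \<le> (1 - (\<Sum>i<n. measure_pmf.prob F {v. t < v ! i})) * a"
    using s a0 by (intro mult_right_mono) auto
  also have "\<dots> \<le> measure_pmf.prob F (\<Union>i<n. {v. x < v ! i} - (\<Union>j<i. {v. t < v ! j}))"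
    unfolding a_def
  proof (rule measure_pmf.prob_first_event_ge)
    fix i j assume "i < n" "j < n" "i \<noteq> j"
    from prophet_instance_indep[OF inst this, of "{x<..}" "{t<..}"]
    show "measure_pmf.prob F ({v. x < v ! i} \<inter> {v. t < v ! j}) =
        measure_pmf.prob F {v. x < v ! i} * measure_pmf.prob F {v. t < v ! j}"
      by simp
  qed (use x in auto)
  also have "\<dots> \<le> u"
    unfolding u_def
  proof (rule prob_pmf_mono)
    fix v assume "v \<in> set_pmf F" and v: "v \<in> (\<Union>i<n. {v. x < v ! i} - (\<Union>j<i. {v. t < v ! j}))"
    from v obtain i where "i < n" "x < v ! i" "\<And>j. j < i \<Longrightarrow> \<not> t < v ! j"
      by blast
    moreover have "length v = n"
      using prophet_instance_length[OF inst \<open>v \<in> set_pmf F\<close>] .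
    \<comment> \<open>As \<open>t \<le> x\<close>, coordinate \<open>i\<close> passes the threshold
      \<open>t\<close> itself, and no earlier one does.\<close>
    ultimately have "find (\<lambda>y. t < y) v = Some (v ! i)"
      using x unfolding find_Some_iff by (intro exI[of _ i]) simp
    with \<open>x < v ! i\<close> show "v \<in> {v. \<exists>y. find (\<lambda>y. t < y) v = Some y \<and> x < y}"
      by simp
  qed
  finally have u: "(1 - \<xi>) * a \<le> u" .
  have "1 - q = measure_pmf.prob F {v. find (\<lambda>y. t < y) v \<noteq> None}"
    using measure_pmf.prob_compl[of "{v. find (\<lambda>y. t < y) v = None}" F]
    by (simp add: q_def Compl_eq_Diff_UNIV[symmetric] Collect_neg_eq[symmetric])
  also have "\<dots> \<le> measure_pmf.prob F (\<Union>i<n. {v. t < v ! i})"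
  proof (rule prob_pmf_mono)
    fix v assume "v \<in> set_pmf F" and "v \<in> {v. find (\<lambda>y. t < y) v \<noteq> None}"
    then obtain i where "i < n" "t < v ! i"
      using prophet_instance_length[OF inst] by (auto simp: find_None_iff in_set_conv_nth)
    then show "v \<in> (\<Union>i<n. {v. t < v ! i})"
      by (intro UN_I[of i]) simp_all
  qed
  also have "\<dots> \<le> (\<Sum>i<n. measure_pmf.prob F {v. t < v ! i})"
    by (intro measure_pmf.finite_measure_subadditive_finite) auto
  finally have q: "1 - \<xi> \<le> q"
    using s by simp
  \<comment> \<open>Two rounds are peeled off and the contribution of all later rounds is
    dropped.\<close>
  have "u + q * u \<le> measure_pmf.prob (replicate_pmf (Suc (Suc k)) F) {vs. x < run_rounds Q vs}"
    unfolding prob_run_rounds_Suc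
    using Q by (auto simp: u_def q_def intro!: mult_left_mono)
  moreover have "a = ((1 - \<xi>) * (2 - \<xi>)) * a"
    by (simp add: xi_identity)
  moreover have "\<dots> = (1 + (1 - \<xi>)) * ((1 - \<xi>) * a)"
    by (simp add: algebra_simps)
  moreover have "\<dots> \<le> (1 + q) * u"
    using u q xi_less_1 a0 by (intro mult_mono) auto
  ultimately show ?thesis
    using max_le by (simp add: algebra_simps)
qed

section \<open>Failure probabilities and Phase 2\<close>

text \<open>Any selection in the first \<open>k\<close> rounds beats \<open>x\<close>, so a run that
  does not beat \<open>x\<close> passes all of them, and the rounds are independent. The last
  \<open>m\<close> rounds may follow any rule.\<close>

lemma prob_run_rounds_survival:
  assumes "\<And>r y. r < k \<Longrightarrow> Q r y \<Longrightarrow> x < y"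
  shows "1 - measure_pmf.prob (replicate_pmf (k + m) F) {vs. x < run_rounds Q vs}
    \<le> (\<Prod>r<k. measure_pmf.prob F {v. find (Q r) v = None})"
  using assms
proof (induction k arbitrary: Q)
  case (Suc k)
  let ?q = "measure_pmf.prob F {v. find (Q 0) v = None}"
  let ?g = "measure_pmf.prob (replicate_pmf (k + m) F) {vs. x < run_rounds (\<lambda>r. Q (Suc r)) vs}"
  have "x < y" if "find (Q 0) v = Some y" for v y
    using Suc.prems[of 0 y] that unfolding find_Some_iff by auto
  then have "{v. \<exists>y. find (Q 0) v = Some y \<and> x < y} = UNIV - {v. find (Q 0) v = None}"
    by auto
  then have "measure_pmf.prob F {v. \<exists>y. find (Q 0) v = Some y \<and> x < y} = 1 - ?q"
    using measure_pmf.prob_compl[of "{v. find (Q 0) v = None}" F] by simp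
  then have "1 - measure_pmf.prob (replicate_pmf (Suc k + m) F) {vs. x < run_rounds Q vs} = ?q * (1 - ?g)"
    unfolding add_Suc prob_run_rounds_Suc by (simp add: algebra_simps)
  also have "\<dots> \<le> ?q * (\<Prod>r<k. measure_pmf.prob F {v. find (Q (Suc r)) v = None})"
    using Suc.prems by (intro mult_left_mono Suc.IH) auto
  finally show ?case
    by (simp only: prod.lessThan_Suc_shift)
qed simp

lemma quantile_max_pmf:
  assumes "is_quantile q (max_pmf F) t"
  shows "measure_pmf.prob F {v. Max (set v) < t} \<le> q"
    and "q \<le> measure_pmf.prob F {v. Max (set v) \<le> t}"
  using assms unfolding is_quantile_def max_pmf_def by (auto simp: vimage_def)

text \<open>If the maximum is below \<open>t\<close>, none of the pairwise independent events
  \<open>t \<le> v ! i\<close> occurs, so the second moment bound applies.\<close>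

lemma prob_max_less_le:
  assumes inst: "prophet_instance n F"
    and s: "\<xi> \<le> (\<Sum>i<n. measure_pmf.prob F {v. t \<le> v ! i})"
  shows "measure_pmf.prob F {v. Max (set v) < t} \<le> 1 / (1 + \<xi>)"
proof -
  have "measure_pmf.prob F {v. Max (set v) < t} \<le>
      measure_pmf.prob F (space F - (\<Union>i<n. {v. t \<le> v ! i}))"
  proof (rule prob_pmf_mono)
    fix v assume "v \<in> set_pmf F" and v: "v \<in> {v. Max (set v) < t}"
    have "v ! i < t" if "i < n" for i
    proof -
      have "v ! i \<in> set v"
        using that prophet_instance_length[OF inst \<open>v \<in> set_pmf F\<close>] by simp
      then have "v ! i \<le> Max (set v)"
        by simp
      with v show ?thesis
        by simp
    qed
    then show "v \<in> space F - (\<Union>i<n. {v. t \<le> v ! i})"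
      by (auto simp: not_le)
  qed
  also have "\<dots> \<le> 1 / (1 + (\<Sum>i<n. measure_pmf.prob F {v. t \<le> v ! i}))"
  proof (rule measure_pmf.prob_no_event_le)
    fix i j assume "i \<in> {..<n}" "j \<in> {..<n}" "i \<noteq> j"
    with prophet_instance_indep[OF inst, of i j "{t..}" "{t..}"]
    show "measure_pmf.prob F ({v. t \<le> v ! i} \<inter> {v. t \<le> v ! j}) =
        measure_pmf.prob F {v. t \<le> v ! i} * measure_pmf.prob F {v. t \<le> v ! j}"
      by simp
  qed auto
  also have "\<dots> \<le> 1 / (1 + \<xi>)"
    using s xi_pos by (intro divide_left_mono) (auto intro!: mult_pos_pos add_pos_nonneg)
  finally show ?thesis .
qed

text \<open>
  Rounds are counted from 0 here, so that \<open>Q\<close> describes \<open>N + 3\<close> active rounds and round \<open>i + 3\<close>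
  uses the threshold \<open>T i\<close>. The quantile levels are such that the first \<open>i + 3\<close> rounds all fail
  with probability at most \<open>p ^ 2 ^ i\<close>, the level of the threshold \<open>T i\<close> that comes next.
\<close>
lemma prob_two_phase_ge:
  fixes T :: "nat \<Rightarrow> real" and N :: nat
  defines "Q \<equiv> (\<lambda>r y. if r < 2 then T 0 < y else r \<le> N + 2 \<and> T (r - 3) \<le> y)"
  assumes inst: "prophet_instance n F" and valid: "valid_thresholds n F T"
    and \<epsilon>: "0 \<le> \<epsilon>" "(1 / (1 + \<xi>)) ^ 2 ^ N \<le> \<epsilon>"
  shows "(1 - \<epsilon>) * measure_pmf.prob F {v. x < Max (set v)}
    \<le> measure_pmf.prob (replicate_pmf (N + 3 + m) F) {vs. x < run_rounds Q vs}"
proof -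
  define p where "p = measure_pmf.prob F {v. Max (set v) < T 0}"
  let ?M = "measure_pmf.prob F {v. x < Max (set v)}"
  let ?g = "measure_pmf.prob (replicate_pmf (N + 3 + m) F) {vs. x < run_rounds Q vs}"
  have T0: "(\<Sum>i<n. measure_pmf.prob F {v. T 0 < v ! i}) \<le> \<xi>"
      "\<xi> \<le> (\<Sum>i<n. measure_pmf.prob F {v. T 0 \<le> v ! i})"
    and quant: "\<And>i. 1 \<le> i \<Longrightarrow> is_quantile (p ^ 2 ^ i) (max_pmf F) (T i)"
    using valid unfolding valid_thresholds_def p_def Let_def by auto
  have p0: "0 \<le> p" and p: "p \<le> 1 / (1 + \<xi>)"
    using prob_max_less_le[OF inst T0(2)] by (auto simp: p_def)
  \<comment> \<open>For \<open>i = 0\<close> this is the definition of \<open>p\<close>, as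
    \<open>2 ^ 0 = 1\<close>.\<close>
  have lower: "measure_pmf.prob F {v. Max (set v) < T i} \<le> p ^ 2 ^ i" for i
    using quantile_max_pmf(1)[OF quant[of i]] by (cases "i = 0") (auto simp: p_def)
  have fail: "(\<Prod>r<i + 3. measure_pmf.prob F {v. find (Q r) v = None}) \<le> p ^ 2 ^ i" if "i \<le> N" for i
    using that
  proof (induction i)
    case 0
    \<comment> \<open>Rounds 0 and 1 are estimated by 1. Round 2 reuses \<open>T 0\<close> with a
      weak inequality and fails with probability exactly \<open>p\<close>.\<close>
    have "Q 2 = (\<lambda>y. T 0 \<le> y)"
      by (auto simp: Q_def)
    then have "(\<Prod>r<0 + 3. measure_pmf.prob F {v. find (Q r) v = None}) =
        measure_pmf.prob F {v. find (Q 0) v = None} * measure_pmf.prob F {v. find (Q 1) v = None} * p"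
      by (simp add: numeral_3_eq_3 numeral_2_eq_2 p_def prob_find_None[OF inst])
    also have "\<dots> \<le> 1 * 1 * p"
      using p0 by (intro mult_mono) auto
    finally show ?case
      by simp
  next
    case (Suc i)
    \<comment> \<open>Round \<open>i + 3\<close> obeys the same bound as all earlier rounds
      together, so the exponent doubles.\<close>
    have "Q (i + 3) = (\<lambda>y. T i \<le> y)"
      using Suc.prems by (auto simp: Q_def)
    then have "measure_pmf.prob F {v. find (Q (i + 3)) v = None} \<le> p ^ 2 ^ i"
      using lower[of i] by (simp add: prob_find_None[OF inst])
    then have "(\<Prod>r<i + 3. measure_pmf.prob F {v. find (Q r) v = None}) *
        measure_pmf.prob F {v. find (Q (i + 3)) v = None} \<le> p ^ 2 ^ i * p ^ 2 ^ i"
      using p0 Suc by (intro mult_mono) auto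
    also have "\<dots> = p ^ 2 ^ Suc i"
      by (simp add: power_add[symmetric] mult_2)
    finally show ?case
      unfolding add_Suc prod.lessThan_Suc .
  qed
  \<comment> \<open>For \<open>i = 0\<close> the condition on \<open>j < i\<close> is empty, yet
    rounds 0 to 2 use \<open>T 0\<close>; hence \<open>x < T 0\<close> is assumed
    separately.\<close>
  have surv: "1 - ?g \<le> p ^ 2 ^ i" if "i \<le> N" "x < T 0" "\<And>j. j < i \<Longrightarrow> x < T j" for i
  proof -
    have "x < T (r - 3)" if "r < i + 3" for r
      using that \<open>x < T 0\<close> \<open>\<And>j. j < i \<Longrightarrow> x < T j\<close> by (cases "r < 3") auto
    then have "x < y" if "r < i + 3" "Q r y" for r y
      using that \<open>x < T 0\<close> less_trans less_le_trans unfolding Q_def by metis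
    then have "1 - measure_pmf.prob (replicate_pmf (i + 3 + (N - i + m)) F) {vs. x < run_rounds Q vs}
        \<le> (\<Prod>r<i + 3. measure_pmf.prob F {v. find (Q r) v = None})"
      by (rule prob_run_rounds_survival)
    also have "\<dots> \<le> p ^ 2 ^ i"
      by (rule fail[OF \<open>i \<le> N\<close>])
    also have "i + 3 + (N - i + m) = N + 3 + m"
      using \<open>i \<le> N\<close> by simp
    finally show ?thesis .
  qed
  have "(1 - \<epsilon>) * ?M \<le> ?M"
    using \<epsilon> by (simp add: algebra_simps)
  \<comment> \<open>Quantile thresholds need not be ordered by index, so the middle case takes the
    least index whose threshold is at most \<open>x\<close>.\<close>
  consider "T 0 \<le> x" | i where "i \<le> N" "x < T 0" "T i \<le> x" "\<And>j. j < i \<Longrightarrow> x < T j"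
    | "x < T 0" "\<And>j. j \<le> N \<Longrightarrow> x < T j"
  proof (cases "\<exists>i\<le>N. T i \<le> x")
    case True
    define i where "i = (LEAST i. T i \<le> x)"
    have "T i \<le> x"
      using True unfolding i_def by (metis LeastI)
    moreover have "i \<le> N"
      using True unfolding i_def by (metis (mono_tags) Least_le order_trans)
    moreover have "x < T j" if "j < i" for j
      using not_less_Least[of j "\<lambda>i. T i \<le> x"] that unfolding i_def by simp
    ultimately show ?thesis
      using that(1,2) by (meson not_le)
  next
    case False
    then show ?thesis
      using that(3) by (meson not_le le0)
  qed
  then show ?thesis
  proof cases
    case 1
    have "?M \<le> measure_pmf.prob (replicate_pmf (Suc (Suc (N + 1 + m))) F) {vs. x < run_rounds Q vs}"
      by (rule prob_run_rounds_above[OF inst T0(1) 1]) (auto simp: Q_def)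
    then have "?M \<le> ?g"
      by (simp add: numeral_3_eq_3)
    with \<open>(1 - \<epsilon>) * ?M \<le> ?M\<close> show ?thesis
      by simp
  next
    case (2 i)
    then have "1 \<le> i"
      by (cases i) auto
    have "p ^ 2 ^ i \<le> measure_pmf.prob F {v. Max (set v) \<le> T i}"
      by (rule quantile_max_pmf(2)[OF quant[OF \<open>1 \<le> i\<close>]])
    also have "\<dots> \<le> measure_pmf.prob F (UNIV - {v. x < Max (set v)})"
      using 2 by (intro measure_pmf.finite_measure_mono) auto
    also have "\<dots> = 1 - ?M"
      using measure_pmf.prob_compl[of "{v. x < Max (set v)}" F] by simp
    finally have "?M \<le> ?g"
      using surv[OF 2(1,2,4)] by linarith
    with \<open>(1 - \<epsilon>) * ?M \<le> ?M\<close> show ?thesis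
      by simp
  next
    case 3
    have "p ^ 2 ^ N \<le> (1 / (1 + \<xi>)) ^ 2 ^ N"
      using p0 p by (intro power_mono)
    moreover have "1 - ?g \<le> p ^ 2 ^ N"
      using 3 by (intro surv) auto
    ultimately have "1 - \<epsilon> \<le> ?g"
      using \<epsilon>(2) by linarith
    \<comment> \<open>The maximum with 0 covers \<open>\<epsilon> > 1\<close>, where the left side
      is not positive.\<close>
    moreover have "(1 - \<epsilon>) * ?M \<le> max 0 (1 - \<epsilon>)"
      by (cases "\<epsilon> \<le> 1") (auto simp: mult_left_le mult_nonpos_nonneg)
    ultimately show ?thesis
      by (smt (verit) measure_nonneg)
  qed
qed

section \<open>Round counts and conclusion\<close>

text \<open>For a round \<open>r\<close> counted from 0, the round within Phase 2 is
  \<open>r - 1\<close> and the threshold index is \<open>r - 3\<close>, truncated at 0. The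
  \<open>N + 1\<close> rounds of Phase 2 end with \<open>r = N + 2\<close>.\<close>

lemma two_phase_eq:
  assumes "phase2_rounds \<epsilon> = int N + 1"
  shows "two_phase T n \<epsilon> F h =
    (if (length h - 1) div n < 2 then T F 0 < last h
     else (length h - 1) div n \<le> N + 2 \<and> T F ((length h - 1) div n - 3) \<le> last h)"
  using assms by (auto simp: two_phase_def Let_def of_nat_diff numeral_3_eq_3 numeral_2_eq_2)

lemma power_le_of_phase2_rounds:
  assumes "0 < \<epsilon>" "\<epsilon> < 1" and N: "phase2_rounds \<epsilon> = int N + 1"
  shows "(1 / (1 + \<xi>)) ^ 2 ^ N \<le> \<epsilon>"
proof -
  have xi: "1 < 1 + \<xi>"
    using xi_pos by simp
  have "0 < log (1 + \<xi>) (1 / \<epsilon>)"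
    using assms xi by simp
  \<comment> \<open>The ceiling equals \<open>N - 1\<close>, so this bound has one unit to
    spare.\<close>
  moreover have "log 2 (log (1 + \<xi>) (1 / \<epsilon>)) \<le> real N"
    using N unfolding phase2_rounds_def by linarith
  ultimately have "log (1 + \<xi>) (1 / \<epsilon>) \<le> 2 powr real N"
    by (simp add: log_le_iff)
  then have "1 / \<epsilon> \<le> (1 + \<xi>) powr (2 ^ N)"
    using assms xi by (simp add: log_le_iff powr_realpow)
  also have "\<dots> = (1 + \<xi>) ^ 2 ^ N"
    using xi powr_realpow[of "1 + \<xi>" "2 ^ N"] by simp
  finally show ?thesis
    using assms xi by (simp add: power_divide field_simps)
qed

theorem theorem5p1:
  fixes n :: nat and \<epsilon> :: real and T :: "real list pmf \<Rightarrow> nat \<Rightarrow> real"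
  assumes "0 < \<epsilon>" and "\<epsilon> < 1"
    and "phase2_rounds \<epsilon> \<ge> 1"
    and "\<And>F. prophet_instance n F \<Longrightarrow> valid_thresholds n F (T F)"
  shows "achieves_competition_complexity (two_phase T n \<epsilon>) n \<epsilon>
           (nat (\<lceil>log 2 (log (1 + \<xi>) (1 / \<epsilon>))\<rceil> + 4)) \<and>
         int (competition_complexity (two_phase T n \<epsilon>) n \<epsilon>)
           \<le> \<lceil>log 2 (log (1 + \<xi>) (1 / \<epsilon>))\<rceil> + 4"
proof -
  obtain N where N: "phase2_rounds \<epsilon> = int N + 1"
    using assms(3) by (metis add.commute zle_iff_zadd)
  \<comment> \<open>Two rounds of Phase 1 and \<open>N + 1\<close> of Phase 2.\<close>
  have K: "\<lceil>log 2 (log (1 + \<xi>) (1 / \<epsilon>))\<rceil> + 4 = int (N + 3)"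
    using N unfolding phase2_rounds_def by simp
  have "ennreal (1 - \<epsilon>) * expected_max F \<le> expected_alg (two_phase T n \<epsilon>) F k"
    if inst: "prophet_instance n F" and k: "N + 3 \<le> k" for F k
  proof -
    obtain m where m: "k = N + 3 + m"
      using k le_Suc_ex by blast
    define Q where "Q = (\<lambda>r y. if r < 2 then T F 0 < y else r \<le> N + 2 \<and> T F (r - 3) \<le> y)"
    have "selected_value (two_phase T n \<epsilon> F) (concat vs) = run_rounds Q vs"
      if "vs \<in> set_pmf (replicate_pmf k F)" for vs
    proof (rule selected_value_concat)
      show "0 < n"
        by (rule prophet_instance_pos[OF inst])
      show "length v = n" if "v \<in> set vs" for v
        using \<open>vs \<in> _\<close> that prophet_instance_length[OF inst] by (auto simp: set_replicate_pmf)
    qed (auto simp: two_phase_eq[OF N] Q_def)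
    then have "expected_alg (two_phase T n \<epsilon>) F k =
        (\<integral>\<^sup>+vs. ennreal (run_rounds Q vs) \<partial>measure_pmf (replicate_pmf k F))"
      \<comment> \<open>The two runs are known to agree on the support, where every round has length
        \<open>n\<close>.\<close>
      unfolding expected_alg_def by (intro nn_integral_cong_AE) (auto simp: AE_measure_pmf_iff)
    moreover have "ennreal (1 - \<epsilon>) * expected_max F \<le> \<dots>"
      unfolding expected_max_def m Q_def
      using assms(1,2) prob_two_phase_ge[OF inst assms(4)[OF inst]]
        power_le_of_phase2_rounds[OF assms(1,2) N]
      by (intro nn_integral_le_of_tail_le) auto
    ultimately show ?thesis
      by simp
  qed
  then have "achieves_competition_complexity (two_phase T n \<epsilon>) n \<epsilon> (N + 3)"
    unfolding achieves_competition_complexity_def by simp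
  moreover from this have "competition_complexity (two_phase T n \<epsilon>) n \<epsilon> \<le> N + 3"
    unfolding competition_complexity_def by (rule Least_le)
  ultimately show ?thesis
    unfolding K by (simp only: nat_int of_nat_le_iff)
qed

end
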